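(* Let $r\in\mathbb{N}$, $m_1,\ldots,m_r\in\mathbb{N}$, $m=\operatorname{lcm}[m_1,\ldots,m_r]$, and $M\in\mathbb{N}$ with $m\mid M$. Let $f_1,\ldots,f_r:\mathbb{N}\to\mathbb{C}$ be arbitrary arithmetical functions and $G=(g_1,\ldots,g_r)$ a system of polynomials with integer coefficients. Then \[ \frac{1}{M}\sum_{k=1}^{M} f_1(\gcd(g_1(k),m_1))\cdots f_r(\gcd(g_r(k),m_r)) =\sum_{d_1\mid m_1,\ldots,d_r\mid m_r}\frac{(\mu*f_1)(d_1)\cdots(\mu*f_r)(d_r)}{\operatorname{lcm}[d_1,\ldots,d_r]}\,N_G(d_1,\ldots,d_r); \] in particular the left-hand side does not depend on the choice of $M$.
   Context: $\mathbb{N}=\{1,2,\ldots\}$. $\mu$ is the Möbius function and $(f*g)(n)=\sum_{d\mid n}f(d)g(n/d)$ the Dirichlet convolution. For a system $G=(g_1,\ldots,g_r)$ of integer polynomials and $d_1,\ldots,d_r\in\mathbb{N}$, $N_G(d_1,\ldots,d_r)$ is the number of residues $x$ modulo $\operatorname{lcm}[d_1,\ldots,d_r]$ such that $g_i(x)\equiv 0\pmod{d_i}$ for all $1\le i\le r$. (Here $\gcd(0,m_i)=m_i$.) *)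

theory Defs
  imports
    Complex_Main
    "HOL-Library.FuncSet"
    "HOL-Computational_Algebra.Polynomial"
    "HOL-Computational_Algebra.Squarefree"
    "HOL-Number_Theory.Cong"
begin

(* Arithmetical functions on the positive integers are total functions on nat;
   their value at 0 carries no meaning. *)

definition moebius :: "nat \<Rightarrow> 'a :: comm_ring_1" where
  "moebius n = (if squarefree n then (-1) ^ card (prime_factors n) else 0)"

definition dirichlet_conv ::
    "(nat \<Rightarrow> 'a :: comm_semiring_1) \<Rightarrow> (nat \<Rightarrow> 'a) \<Rightarrow> nat \<Rightarrow> 'a" where
  "dirichlet_conv f g n = (\<Sum>d | d dvd n. f d * g (n div d))"

(* Systems (g_1, ..., g_r) and (d_1, ..., d_r) are families on nat, of which only the
   entries with index in {1..r} are used. Residues modulo the lcm are represented by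
   their least nonnegative representatives. *)

definition num_sols :: "nat \<Rightarrow> (nat \<Rightarrow> int poly) \<Rightarrow> (nat \<Rightarrow> nat) \<Rightarrow> nat" where
  "num_sols r g d =
     card {x :: int. x \<in> {0..<int (LCM i\<in>{1..r}. d i)} \<and>
                     (\<forall>i\<in>{1..r}. [poly (g i) x = 0] (mod int (d i)))}"

end

theory Submission
  imports Defs
begin

text \<open>
  Moebius inversion writes each factor as a sum of \<open>(\<mu> * f\<^sub>i)(d)\<close> over the divisors \<open>d\<close> of
  \<open>m\<^sub>i\<close> that divide \<open>g\<^sub>i(k)\<close>. After expanding the product and exchanging the sums, one has to count
  the \<open>k \<le> M\<close> with \<open>d\<^sub>i\<close> dividing \<open>g\<^sub>i(k)\<close> for all \<open>i\<close>; this condition is periodic in \<open>k\<close> modulo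
  the least common multiple of the \<open>d\<^sub>i\<close>, which divides \<open>M\<close>.
\<close>

text \<open>Together with \<open>prod_prime_factors_squarefree\<close> this makes
  \<open>Prod\<close> and \<open>prime_factors\<close> mutually inverse between finite sets of
  primes and squarefree numbers, the bijection behind the evaluation of the Moebius sum.\<close>

lemma
  fixes S :: "nat set"
  assumes "finite S" "\<And>p. p \<in> S \<Longrightarrow> prime p"
  shows squarefree_prod_primes: "squarefree (\<Prod>S)"
    and prime_factors_prod_primes: "prime_factors (\<Prod>S) = S"
proof -
  show "squarefree (\<Prod>S)"
    using assms by (intro squarefree_prod_coprime primes_coprime squarefree_prime) auto
  have "prime_factorization (prod_mset (mset_set S)) = mset_set S"
    using assms by (intro prime_factorization_prod_mset_primes) auto
  then show "prime_factors (\<Prod>S) = S"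
    using assms by (simp add: prod_unfold_prod_mset)
qed

lemma prod_prime_factors_squarefree:
  fixes n :: nat
  assumes "squarefree n"
  shows "\<Prod>(prime_factors n) = n"
proof -
  have "n > 0"
    using assms by (intro Nat.gr0I) auto
  then have "n = (\<Prod>p\<in>prime_factors n. p ^ multiplicity p n)"
    by (rule prime_factorization_nat)
  also have "\<dots> = \<Prod>(prime_factors n)"
    using assms \<open>n > 0\<close> by (intro prod.cong) (auto simp: squarefree_factorial_semiring')
  finally show ?thesis by simp
qed

text \<open>Only squarefree divisors contribute. They are the products of the sets X of prime
  factors of n, and each contributes \<open>(-1) ^ card X\<close>, which leaves an alternating sum
  over a power set.\<close>

lemma sum_moebius_divisors:
  fixes n :: nat
  assumes "n > 0"
  shows "(\<Sum>d | d dvd n. moebius d :: 'a :: comm_ring_1) = (if n = 1 then 1 else 0)"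
proof -
  have "(\<Sum>d | d dvd n. moebius d :: 'a) = (\<Sum>d | d dvd n \<and> squarefree d. moebius d)"
    using assms by (intro sum.mono_neutral_right) (auto simp: moebius_def)
  also have "\<dots> = (\<Sum>X\<in>Pow (prime_factors n). (-1) ^ card X)"
  proof (rule sum.reindex_bij_witness[of _ Prod prime_factors])
    fix X assume X: "X \<in> Pow (prime_factors n)"
    then have fin: "finite X" and primes: "\<And>p. p \<in> X \<Longrightarrow> prime p"
      by (auto intro: finite_subset)
    show "prime_factors (\<Prod>X) = X"
      using fin primes by (rule prime_factors_prod_primes)
    \<comment> \<open>Every prime in X occurs in the factorization of n with positive exponent, so
      factorwise divisibility suffices.\<close>
    have "\<Prod>X dvd (\<Prod>p\<in>prime_factors n. p ^ multiplicity p n)"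
    proof (rule prod_dvd_prod_subset2)
      show "p dvd p ^ multiplicity p n" if "p \<in> X" for p
        using X that by (intro dvd_power) (auto simp: prime_factors_multiplicity)
    qed (use X in auto)
    also have "\<dots> = n"
      using assms by (rule prime_factorization_nat[symmetric])
    finally show "\<Prod>X \<in> {d. d dvd n \<and> squarefree d}"
      using squarefree_prod_primes[OF fin primes] by auto
  qed (use assms in \<open>auto simp: prod_prime_factors_squarefree moebius_def
                         prime_factors_dvd dest: dvd_trans\<close>)
  \<comment> \<open>The signed sum over subsets is the expanded form of a product of factors 1 - 1;
    that product is empty, hence 1, exactly for n = 1.\<close>
  also have "\<dots> = (\<Prod>p\<in>prime_factors n. 1 - 1)"
    by (subst prod_diff_conv_sum) auto
  also have "\<dots> = (if n = 1 then 1 else 0)"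
    using assms by (auto simp: prime_factorization_empty_iff power_0_left)
  finally show ?thesis .
qed

text \<open>Substituting d = a * b and summing over a first gives \<open>f b\<close> the coefficient
  \<open>sum_moebius_divisors\<close> of \<open>n div b\<close>, which vanishes unless b =
  n.\<close>

lemma moebius_inversion:
  fixes f :: "nat \<Rightarrow> 'a :: comm_ring_1"
  assumes "n > 0"
  shows "(\<Sum>d | d dvd n. dirichlet_conv moebius f d) = f n"
proof -
  have "(\<Sum>d | d dvd n. dirichlet_conv moebius f d) =
        (\<Sum>(d, a)\<in>(SIGMA d:{d. d dvd n}. {a. a dvd d}). moebius a * f (d div a))"
    using assms unfolding dirichlet_conv_def
    by (subst sum.Sigma) (auto intro: finite_divisors_nat dvd_pos_nat)
  also have "\<dots> = (\<Sum>(b, a)\<in>(SIGMA b:{b. b dvd n}. {a. a dvd n div b}). moebius a * f b)"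
  proof (rule sum.reindex_bij_witness[of _ "\<lambda>(b, a). (a * b, a)" "\<lambda>(d, a). (d div a, a)"])
    fix x assume "x \<in> (SIGMA b:{b. b dvd n}. {a. a dvd n div b})"
    then obtain a b c where "x = (b, a)" "n = b * (a * c)" "b > 0" "a > 0"
      using assms by (auto elim!: dvdE)
    then show "(case case x of (b, a) \<Rightarrow> (a * b, a) of (d, a) \<Rightarrow> (d div a, a)) = x"
      and "(case x of (b, a) \<Rightarrow> (a * b, a)) \<in> (SIGMA d:{d. d dvd n}. {a. a dvd d})"
      by auto
  next
    fix x assume "x \<in> (SIGMA d:{d. d dvd n}. {a. a dvd d})"
    then obtain a b c where "x = (a * b, a)" "n = a * b * c" "b > 0" "a > 0"
      using assms by (auto elim!: dvdE)
    then show "(case case x of (d, a) \<Rightarrow> (d div a, a) of (b, a) \<Rightarrow> (a * b, a)) = x"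
      and "(case x of (d, a) \<Rightarrow> (d div a, a)) \<in> (SIGMA b:{b. b dvd n}. {a. a dvd n div b})"
      and "(case case x of (d, a) \<Rightarrow> (d div a, a) of (b, a) \<Rightarrow> moebius a * f b) =
           (case x of (d, a) \<Rightarrow> moebius a * f (d div a))"
      by (auto simp: mult_ac)
  qed
  also have "\<dots> = (\<Sum>b | b dvd n. \<Sum>a | a dvd n div b. moebius a * f b)"
    using assms by (subst sum.Sigma) (auto simp: dvd_div_eq_0_iff intro!: finite_divisors_nat Nat.gr0I)
  also have "\<dots> = (\<Sum>b | b dvd n. if b = n then f n else 0)"
  proof (rule sum.cong)
    fix b assume "b \<in> {b. b dvd n}"
    then obtain c where c: "n = b * c" by auto
    then have "b > 0" "c > 0" using assms by auto
    then show "(\<Sum>a | a dvd n div b. moebius a * f b) = (if b = n then f n else 0)"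
      using sum_moebius_divisors[of c, where 'a = 'a] c
      by (auto simp flip: sum_distrib_right)
  qed simp
  also have "\<dots> = f n"
    using assms by simp
  finally show ?thesis .
qed

text \<open>The interval splits into q blocks of length L, each a complete residue system modulo
  L.\<close>

lemma card_periodic:
  fixes P :: "int \<Rightarrow> bool" and L q :: nat
  assumes periodic: "\<And>x y. [x = y] (mod int L) \<Longrightarrow> P x \<longleftrightarrow> P y"
  shows "card {k\<in>{1..L * q}. P (int k)} = q * card {x. x \<in> {0..<int L} \<and> P x}"
proof -
  define h where "h = (\<lambda>k. if P (int k) then 1 else 0 :: nat)"
  have h_periodic: "h (x + j * L) = h x" for x j
    using periodic[of "int (x + j * L)" "int x"] by (simp add: h_def cong_def)
  have "card {k\<in>{1..L * q}. P (int k)} = sum h {1..L * q}"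
    by (simp add: h_def sum.If_cases Int_def)
  \<comment> \<open>Moving to an interval that starts at 0 trades the last term
    \<open>h (L * q)\<close> for \<open>h 0\<close>, which periodicity makes equal. If L * q = 0,
    both intervals are empty.\<close>
  also have "\<dots> = sum h {..<q * L}"
  proof (cases "L * q")
    case (Suc N)
    have "sum h {..<q * L} = h 0 + sum h {1..<L * q}"
      using Suc by (simp add: sum.atLeast_Suc_lessThan lessThan_atLeast0 mult.commute)
    also have "h 0 = h (L * q)"
      using h_periodic[of 0 q] by (simp add: mult.commute)
    also have "\<dots> + sum h {1..<L * q} = sum h {1..L * q}"
      using Suc by (simp add: sum.last_plus)
    finally show ?thesis by simp
  qed (auto simp: mult.commute)
  also have "\<dots> = (\<Sum>j<q. sum h {j * L..<j * L + L})"
    by (rule sum.nat_group[symmetric])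
  also have "\<dots> = (\<Sum>j<q. sum h {0..<L})"
  proof (rule sum.cong)
    fix j
    show "sum h {j * L..<j * L + L} = sum h {0..<L}"
      using sum.shift_bounds_nat_ivl[of h 0 "j * L" L] by (simp add: h_periodic add.commute)
  qed simp
  also have "\<dots> = q * card {k\<in>{0..<L}. P (int k)}"
    by (simp add: h_def sum.If_cases Int_def)
  \<comment> \<open>The summation index is a natural number, while residues are counted as integers;
    \<open>int\<close> matches the two sets.\<close>
  also have "card {k\<in>{0..<L}. P (int k)} = card (int ` {k\<in>{0..<L}. P (int k)})"
    by (rule card_image[symmetric]) simp
  also have "int ` {k\<in>{0..<L}. P (int k)} = {x. x \<in> {0..<int L} \<and> P x}"
  proof (intro equalityI subsetI)
    fix x assume "x \<in> {x. x \<in> {0..<int L} \<and> P x}"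
    then show "x \<in> int ` {k\<in>{0..<L}. P (int k)}"
      by (intro image_eqI[of _ _ "nat x"]) auto
  qed auto
  finally show ?thesis .
qed

lemma cong_poly:
  fixes p :: "'a :: {comm_ring_1, unique_euclidean_semiring} poly"
  assumes "[x = y] (mod n)"
  shows "[poly p x = poly p y] (mod n)"
  using assms by (induction p) (auto intro!: cong_add cong_mult)

text \<open>Each congruence depends only on x modulo \<open>d i\<close>, hence only on x modulo the
  lcm, so \<open>card_periodic\<close> applies with \<open>M div L\<close> blocks.\<close>

lemma card_polynomial_system:
  assumes "(LCM i\<in>{1..r}. d i) dvd M"
  shows "card {k\<in>{1..M}. \<forall>i\<in>{1..r}. int (d i) dvd poly (g i) (int k)} =
         M div (LCM i\<in>{1..r}. d i) * num_sols r g d"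
proof -
  define L where "L = (LCM i\<in>{1..r}. d i)"
  define P where "P = (\<lambda>x. \<forall>i\<in>{1..r}. [poly (g i) x = 0] (mod int (d i)))"
  have "P x \<longleftrightarrow> P y" if "[x = y] (mod int L)" for x y
  proof -
    have "[poly (g i) x = poly (g i) y] (mod int (d i))" if "i \<in> {1..r}" for i
    proof -
      have "int (d i) dvd int L"
        using that by (auto simp: L_def intro!: dvd_Lcm)
      with \<open>[x = y] (mod int L)\<close> show ?thesis
        by (intro cong_poly) (rule cong_dvd_modulus)
    qed
    then show ?thesis
      unfolding P_def by (meson cong_sym cong_trans)
  qed
  from card_periodic[of L P "M div L", OF this] show ?thesis
    using assms unfolding num_sols_def L_def[symmetric] by (simp add: P_def cong_0_iff)
qed

text \<open>The right-hand side does not mention M, so independence of M comes from using this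
  identity for two values of M.\<close>

lemma gcd_sum_eq:
  fixes f :: "nat \<Rightarrow> nat \<Rightarrow> 'a :: field_char_0"
  assumes m: "\<And>i. i \<in> {1..r} \<Longrightarrow> m i \<ge> 1"
    and "M \<ge> 1"
    and M: "(LCM i\<in>{1..r}. m i) dvd M"
  shows "1 / of_nat M *
           (\<Sum>k=1..M. \<Prod>i=1..r. f i (nat (gcd (poly (g i) (int k)) (int (m i))))) =
         (\<Sum>d\<in>(\<Pi>\<^sub>E i\<in>{1..r}. {e. e dvd m i}).
            (\<Prod>i=1..r. dirichlet_conv moebius (f i) (d i)) / of_nat (LCM i\<in>{1..r}. d i)
              * of_nat (num_sols r g d))"
proof -
  define D where "D = (\<Pi>\<^sub>E i\<in>{1..r}. {e. e dvd m i})"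
  define F where "F = (\<lambda>i. dirichlet_conv moebius (f i))"
  define Q where "Q = (\<lambda>d k. \<forall>i\<in>{1..r}. int (d i) dvd poly (g i) (int k))"
  have fin: "finite {e. e dvd m i}" if "i \<in> {1..r}" for i
    using m[OF that] by (intro finite_divisors_nat) simp
  have factor: "f i (nat (gcd (poly (g i) (int k)) (int (m i)))) =
      (\<Sum>e | e dvd m i. if int e dvd poly (g i) (int k) then F i e else 0)"
    if i: "i \<in> {1..r}" for i k
  proof -
    define n where "n = nat (gcd (poly (g i) (int k)) (int (m i)))"
    have int_n: "int n = gcd (poly (g i) (int k)) (int (m i))"
      by (simp add: n_def)
    \<comment> \<open>This covers a zero of the polynomial at k too: there the gcd is
      \<open>int (m i)\<close>, which is positive.\<close>
    have "int n > 0"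
      using m[OF i] unfolding int_n by simp
    then have "f i n = (\<Sum>e | e dvd n. F i e)"
      by (simp add: F_def moebius_inversion)
    \<comment> \<open>Splitting divisibility of the gcd moves the dependence on k from the range of
      summation into an indicator, so the sums can be exchanged later.\<close>
    also have "e dvd n \<longleftrightarrow> e dvd m i \<and> int e dvd poly (g i) (int k)" for e
      using int_n by (metis gcd_greatest_iff int_dvd_int_iff)
    then have "(\<Sum>e | e dvd n. F i e) =
        (\<Sum>e | e dvd m i. if int e dvd poly (g i) (int k) then F i e else 0)"
      using fin[OF i] by (simp add: sum.If_cases Int_def)
    finally show ?thesis
      unfolding n_def .
  qed
  have "(\<Sum>k=1..M. \<Prod>i=1..r. f i (nat (gcd (poly (g i) (int k)) (int (m i))))) =
        (\<Sum>k=1..M. \<Prod>i=1..r.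
           \<Sum>e | e dvd m i. if int e dvd poly (g i) (int k) then F i e else 0)"
    by (intro sum.cong prod.cong refl factor)
  \<comment> \<open>Distributivity: one divisor is chosen for each index. The families in D are
    extensional, so each tuple of divisors is counted once.\<close>
  also have "\<dots> = (\<Sum>k=1..M. \<Sum>d\<in>D. \<Prod>i=1..r.
                      if int (d i) dvd poly (g i) (int k) then F i (d i) else 0)"
    unfolding D_def by (intro sum.cong refl prod_sum_PiE fin) auto
  \<comment> \<open>A single failing divisibility makes the whole product zero.\<close>
  also have "\<dots> = (\<Sum>k=1..M. \<Sum>d\<in>D. if Q d k then \<Prod>i=1..r. F i (d i) else 0)"
    by (intro sum.cong refl) (auto simp: Q_def intro!: prod.cong prod_zero)
  also have "\<dots> = (\<Sum>d\<in>D. \<Sum>k=1..M. if Q d k then \<Prod>i=1..r. F i (d i) else 0)"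
    by (rule sum.swap)
  also have "\<dots> = (\<Sum>d\<in>D. (\<Prod>i=1..r. F i (d i)) * of_nat (card {k\<in>{1..M}. Q d k}))"
    by (simp add: sum.If_cases Int_def mult.commute)
  finally have "1 / of_nat M *
        (\<Sum>k=1..M. \<Prod>i=1..r. f i (nat (gcd (poly (g i) (int k)) (int (m i))))) =
      (\<Sum>d\<in>D. (\<Prod>i=1..r. F i (d i)) * of_nat (card {k\<in>{1..M}. Q d k}) / of_nat M)"
    by (simp add: sum_divide_distrib)
  also have "\<dots> = (\<Sum>d\<in>D. (\<Prod>i=1..r. F i (d i)) / of_nat (LCM i\<in>{1..r}. d i)
                             * of_nat (num_sols r g d))"
  proof (rule sum.cong)
    fix d assume "d \<in> D"
    define L where "L = (LCM i\<in>{1..r}. d i)"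
    have "L dvd (LCM i\<in>{1..r}. m i)"
      unfolding L_def
    proof (rule Lcm_least)
      fix e assume "e \<in> d ` {1..r}"
      then obtain i where "i \<in> {1..r}" "e dvd m i"
        using \<open>d \<in> D\<close> by (auto simp: D_def PiE_def Pi_def)
      then show "e dvd (LCM i\<in>{1..r}. m i)"
        by (meson dvd_Lcm dvd_trans imageI)
    qed
    then have "L dvd M"
      using M by (rule dvd_trans)
    \<comment> \<open>The count is c times the number of solutions, and c / M = 1 / L because M is
      nonzero.\<close>
    then obtain c where c: "M = L * c" ..
    have "card {k\<in>{1..M}. Q d k} = c * num_sols r g d"
      using card_polynomial_system[of d r M g, folded L_def] \<open>L dvd M\<close> c \<open>M \<ge> 1\<close>
      by (simp add: Q_def)
    then show "(\<Prod>i=1..r. F i (d i)) * of_nat (card {k\<in>{1..M}. Q d k}) / of_nat M =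
        (\<Prod>i=1..r. F i (d i)) / of_nat (LCM i\<in>{1..r}. d i) * of_nat (num_sols r g d)"
      unfolding L_def[symmetric] using c \<open>M \<ge> 1\<close> by auto
  qed simp
  finally show ?thesis
    unfolding D_def F_def .
qed

theorem theorem1:
  fixes r M :: nat
    and m :: "nat \<Rightarrow> nat"
    and f :: "nat \<Rightarrow> nat \<Rightarrow> complex"
    and g :: "nat \<Rightarrow> int poly"
  assumes "r \<ge> 1"
    and "\<And>i. i \<in> {1..r} \<Longrightarrow> m i \<ge> 1"
    and "M \<ge> 1"
    and "(LCM i\<in>{1..r}. m i) dvd M"
  shows "1 / of_nat M *
           (\<Sum>k=1..M. \<Prod>i=1..r. f i (nat (gcd (poly (g i) (int k)) (int (m i))))) =
         (\<Sum>d\<in>(\<Pi>\<^sub>E i\<in>{1..r}. {e. e dvd m i}).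
            (\<Prod>i=1..r. dirichlet_conv moebius (f i) (d i)) / of_nat (LCM i\<in>{1..r}. d i)
              * of_nat (num_sols r g d))
       \<and> (\<forall>M'\<ge>1. (LCM i\<in>{1..r}. m i) dvd M' \<longrightarrow>
            1 / of_nat M' *
              (\<Sum>k=1..M'. \<Prod>i=1..r. f i (nat (gcd (poly (g i) (int k)) (int (m i))))) =
            1 / of_nat M *
              (\<Sum>k=1..M. \<Prod>i=1..r. f i (nat (gcd (poly (g i) (int k)) (int (m i))))))"
  \<comment> \<open>The modulus is left schematic, so that the averages for \<open>M\<close> and for
    \<open>M'\<close> both rewrite to the same divisor sum.\<close>
  using gcd_sum_eq[of r m _ f g] assms(2-4) by simp

end
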